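(* Let $Y$ be a member of the family $\{Y(u):u\in\mathcal{U}\}$, and let $\nu$ be the asymptotic distribution of $Y$ under $\tau$, with free cumulants $(r_n)_{n\ge1}$. Let $\psi(z)=\sum_{n\ge1}Q_nz^n$ and $\psi^{(s)}(z)=\sum_{k\ge1}Q_{2k}z^{2k}$, where $$Q_n=\sum_{\pi\in\mathcal{NC}(U_n)}\ \prod_{V\in\pi}r_{|V|},\qquad n\ge1.$$ Then, as formal power series, $$\psi(z)=R_{\widetilde\nu}\big(z(\psi(z)+1)(\psi^{(s)}(z)+1)\big),$$ where $\widetilde\nu$ is the distribution defined by the even free cumulants of $\nu$, i.e. $R_{\widetilde\nu}(z)=\sum_{n=1}^\infty r_{2n}z^n$.
   Context: **Random matrices.** $\{Y(u):u\in\mathcal{U}\}$ is a family of independent Hermitian $n\times n$ random matrices (dependence on $n$ is suppressed) such that, for $\tau(A)=\frac1n\mathbb{E}(\mathrm{Tr}(A))$: the family is asymptotically free under $\tau$; it is asymptotically free under $\tau$ against the family of deterministic diagonal matrices; and the norms of the matrices $Y(u)$ are uniformly bounded almost surely. **Words.** Put $w_1^*=1^*1$ and $w_2=22^*$. For $n\ge1$ the word $U_n$, of length $2n$, is $$U_{2m}=(w_1^*w_2)^m,\qquad U_{2m+1}=(w_1^*w_2)^mw_1^*.$$ All letters $1,2,1^*,2^*$ carry the same label, so no label restriction is imposed on blocks. **Adapted partitions.** For a noncrossing partition $\pi$ of $\{1,\ldots,2n\}$ and a block $V=\{s_1<\ldots<s_m\}$ put $\pi(s_i)=s_{i+1}$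 for $i<m$ and $\pi(s_m)=s_1$. The element $s$ is colored by the $s$-th letter of $U_n$. $\mathcal{NC}(U_n)$ is the set of noncrossing partitions $\pi$ of $\{1,\ldots,2n\}$ adapted to $U_n$, i.e. such that for each $s$ the pair of colors of $(s,\pi(s))$ belongs to $$\{(1,2),\ (1,1^* ),\ (2,2^* ),\ (1^*,1),\ (2^*,2),\ (2^*,1^* )\}.$$ (All blocks of such partitions have even cardinality.) *)

theory Defs
  imports
    "HOL-Probability.Probability"
    "HOL-Computational_Algebra.Computational_Algebra"
    "Jordan_Normal_Form.Schur_Decomposition"
begin

section \<open>Random matrices and their asymptotics\<close>

text \<open>A (sequence of) random matrices is a function \<open>X\<close>, where \<open>X n\<close> is an \<open>n \<times> n\<close> matrix over the
  probability space \<open>M n\<close>. The space may vary with \<open>n\<close>.\<close>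

type_synonym 'w rmat = "nat \<Rightarrow> 'w \<Rightarrow> complex mat"

definition mat_trace :: "complex mat \<Rightarrow> complex" where
  "mat_trace A = (\<Sum>i<dim_row A. A $$ (i, i))"

definition vec_l2norm :: "complex vec \<Rightarrow> real" where
  "vec_l2norm v = sqrt (\<Sum>i<dim_vec v. (cmod (vec_index v i))\<^sup>2)"

definition mat_opnorm :: "complex mat \<Rightarrow> real" where
  "mat_opnorm A = (SUP v \<in> {v \<in> carrier_vec (dim_col A). vec_l2norm v \<le> 1}. vec_l2norm (A *\<^sub>v v))"

definition random_matrix :: "(nat \<Rightarrow> 'w measure) \<Rightarrow> 'w rmat \<Rightarrow> bool" where
  "random_matrix M X \<longleftrightarrow>
    (\<forall>n. (\<forall>\<omega>\<in>space (M n). X n \<omega> \<in> carrier_mat n n) \<and>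
         (\<forall>i<n. \<forall>j<n. (\<lambda>\<omega>. X n \<omega> $$ (i, j)) \<in> borel_measurable (M n)))"

definition hermitian_random_matrix :: "(nat \<Rightarrow> 'w measure) \<Rightarrow> 'w rmat \<Rightarrow> bool" where
  "hermitian_random_matrix M X \<longleftrightarrow>
    random_matrix M X \<and> (\<forall>n. \<forall>\<omega>\<in>space (M n). mat_adjoint (X n \<omega>) = X n \<omega>)"

text \<open>Independence of matrices is independence of their arrays of entries.\<close>

definition indep_random_matrices ::
    "(nat \<Rightarrow> 'w measure) \<Rightarrow> 'u set \<Rightarrow> ('u \<Rightarrow> 'w rmat) \<Rightarrow> bool" where
  "indep_random_matrices M U Y \<longleftrightarrow>
    (\<forall>n. prob_space.indep_vars (M n) (\<lambda>u. \<Pi>\<^sub>M ij\<in>{..<n} \<times> {..<n}. borel)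
           (\<lambda>u \<omega>. \<lambda>ij\<in>{..<n} \<times> {..<n}. Y u n \<omega> $$ ij) U)"

definition uniformly_bounded_ae ::
    "(nat \<Rightarrow> 'w measure) \<Rightarrow> 'u set \<Rightarrow> ('u \<Rightarrow> 'w rmat) \<Rightarrow> bool" where
  "uniformly_bounded_ae M U Y \<longleftrightarrow>
    (\<exists>C. \<forall>u\<in>U. \<forall>n. AE \<omega> in M n. mat_opnorm (Y u n \<omega>) \<le> C)"

definition tau :: "(nat \<Rightarrow> 'w measure) \<Rightarrow> 'w rmat \<Rightarrow> nat \<Rightarrow> complex" where
  "tau M X n = (\<integral>\<omega>. mat_trace (X n \<omega>) \<partial>M n) / of_nat n"

text \<open>The elements of the unital algebra generated by \<open>S\<close> are the noncommutative polynomials, with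
  coefficients not depending on \<open>n\<close>, in the elements of \<open>S\<close>.\<close>

inductive_set gen_alg :: "'w rmat set \<Rightarrow> 'w rmat set" for S :: "'w rmat set" where
  one: "(\<lambda>n \<omega>. 1\<^sub>m n) \<in> gen_alg S"
| gen: "X \<in> S \<Longrightarrow> X \<in> gen_alg S"
| add: "X \<in> gen_alg S \<Longrightarrow> Z \<in> gen_alg S \<Longrightarrow> (\<lambda>n \<omega>. X n \<omega> + Z n \<omega>) \<in> gen_alg S"
| smult: "X \<in> gen_alg S \<Longrightarrow> (\<lambda>n \<omega>. c \<cdot>\<^sub>m X n \<omega>) \<in> gen_alg S"
| mult: "X \<in> gen_alg S \<Longrightarrow> Z \<in> gen_alg S \<Longrightarrow> (\<lambda>n \<omega>. X n \<omega> * Z n \<omega>) \<in> gen_alg S"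

definition has_limit_distribution :: "(nat \<Rightarrow> 'w measure) \<Rightarrow> 'w rmat set \<Rightarrow> bool" where
  "has_limit_distribution M S \<longleftrightarrow> (\<forall>X\<in>gen_alg S. convergent (tau M X))"

definition rmat_prod :: "'w rmat list \<Rightarrow> 'w rmat" where
  "rmat_prod Xs = foldr (\<lambda>X Z n \<omega>. X n \<omega> * Z n \<omega>) Xs (\<lambda>n \<omega>. 1\<^sub>m n)"

text \<open>Asymptotic freeness of the sets \<open>S i\<close>, \<open>i \<in> I\<close>: the limit joint distribution exists, and with
  respect to it the sets of variables are free, i.e.\ alternating products of elements that are
  centered in the limit are again centered in the limit.\<close>

definition asymptotically_free ::
    "(nat \<Rightarrow> 'w measure) \<Rightarrow> 'i set \<Rightarrow> ('i \<Rightarrow> 'w rmat set) \<Rightarrow> bool" where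
  "asymptotically_free M I S \<longleftrightarrow>
    has_limit_distribution M (\<Union>i\<in>I. S i) \<and>
    (\<forall>js Xs. js \<noteq> [] \<and> length Xs = length js \<and> set js \<subseteq> I \<and> distinct_adj js \<and>
       (\<forall>k<length js. Xs ! k \<in> gen_alg (S (js ! k)) \<and> tau M (Xs ! k) \<longlonglongrightarrow> 0)
       \<longrightarrow> tau M (rmat_prod Xs) \<longlonglongrightarrow> 0)"

definition deterministic_diagonal :: "'w rmat set" where
  "deterministic_diagonal =
    {\<lambda>n \<omega>. D n | D. (\<forall>n. D n \<in> carrier_mat n n \<and> diagonal_mat (D n)) \<and>
                     (\<exists>C. \<forall>n. mat_opnorm (D n) \<le> C)}"

text \<open>Since a sequence of diagonal matrices need not have a limit distribution, asymptotic freeness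
  against the deterministic diagonal matrices refers to all families of (norm bounded) such
  matrices that do have one.\<close>

definition asymptotically_free_from_diagonal ::
    "(nat \<Rightarrow> 'w measure) \<Rightarrow> 'w rmat set \<Rightarrow> bool" where
  "asymptotically_free_from_diagonal M S \<longleftrightarrow>
    (\<forall>\<D>\<subseteq>deterministic_diagonal. has_limit_distribution M \<D> \<longrightarrow>
       asymptotically_free M (UNIV :: bool set) (\<lambda>b. if b then S else \<D>))"


section \<open>Distributions and free cumulants\<close>

text \<open>A distribution is a unital linear functional on the polynomials. It is not required to come
  from a probability measure: a distribution given by the even free cumulants of another one
  need not be positive.\<close>

definition is_distribution :: "(complex poly \<Rightarrow> complex) \<Rightarrow> bool" where
  "is_distribution \<mu> \<longleftrightarrow> \<mu> 1 = 1 \<and> (\<forall>p q. \<mu> (p + q) = \<mu> p + \<mu> q) \<and>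
    (\<forall>c p. \<mu> (Polynomial.smult c p) = c * \<mu> p)"

definition moment :: "(complex poly \<Rightarrow> complex) \<Rightarrow> nat \<Rightarrow> complex" where
  "moment \<mu> n = \<mu> (Polynomial.monom 1 n)"

definition asymptotic_distribution ::
    "(nat \<Rightarrow> 'w measure) \<Rightarrow> 'w rmat \<Rightarrow> (complex poly \<Rightarrow> complex) \<Rightarrow> bool" where
  "asymptotic_distribution M X \<mu> \<longleftrightarrow>
    is_distribution \<mu> \<and> (\<forall>k. tau M (\<lambda>n \<omega>. X n \<omega> ^\<^sub>m k) \<longlonglongrightarrow> moment \<mu> k)"

definition noncrossing :: "nat set set \<Rightarrow> bool" where
  "noncrossing P \<longleftrightarrow>
    (\<forall>V\<in>P. \<forall>W\<in>P. V \<noteq> W \<longrightarrow>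
       \<not> (\<exists>a b c d. a < b \<and> b < c \<and> c < d \<and> a \<in> V \<and> c \<in> V \<and> b \<in> W \<and> d \<in> W))"

definition NC :: "nat \<Rightarrow> nat set set set" where
  "NC n = {P. partition_on {1..n} P \<and> noncrossing P}"

lemma finite_NC [simp]: "finite (NC n)"
proof (rule finite_subset)
  show "NC n \<subseteq> Pow (Pow {1..n})"
    unfolding NC_def partition_on_def by blast
qed auto

lemma NC_block_card:
  assumes "P \<in> NC n" "P \<noteq> {{1..n}}" "V \<in> P"
  shows "card V < n"
proof -
  have part: "partition_on {1..n} P"
    using assms(1) by (simp add: NC_def)
  have sub: "V \<subseteq> {1..n}"
    using part assms(3) by (auto simp: partition_on_def)
  have "V \<noteq> {1..n}"
  proof
    assume V: "V = {1..n}"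
    have "W = V" if "W \<in> P" for W
    proof (rule ccontr)
      assume "W \<noteq> V"
      then have "W \<inter> V = {}"
        using part that assms(3) by (auto simp: partition_on_def disjoint_def)
      moreover have "W \<subseteq> V" "W \<noteq> {}"
        using part that V by (auto simp: partition_on_def)
      ultimately show False by blast
    qed
    then have "P = {{1..n}}" using assms(3) V by blast
    with assms(2) show False ..
  qed
  with sub have "V \<subset> {1..n}" by blast
  then have "card V < card {1..n}" by (intro psubset_card_mono) auto
  then show ?thesis by simp
qed

lemma top_in_NC: "n > 0 \<Longrightarrow> {{1..n}} \<in> NC n"
  by (auto simp: NC_def noncrossing_def partition_on_def disjoint_def)

text \<open>Free cumulants, obtained by solving the moment-cumulant formula recursively; the formula
  itself is \<open>moment_cumulant\<close> below.\<close>

function free_cumulant :: "(complex poly \<Rightarrow> complex) \<Rightarrow> nat \<Rightarrow> complex" where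
  "free_cumulant \<mu> n =
    (if n = 0 then 0
     else moment \<mu> n - (\<Sum>P\<in>NC n - {{{1..n}}}. \<Prod>V\<in>P. free_cumulant \<mu> (card V)))"
  by auto
termination
  by (relation "Wellfounded.measure snd") (auto intro: NC_block_card)

declare free_cumulant.simps [simp del]

lemma moment_cumulant:
  assumes "n > 0"
  shows "moment \<mu> n = (\<Sum>P\<in>NC n. \<Prod>V\<in>P. free_cumulant \<mu> (card V))"
proof -
  have "(\<Sum>P\<in>NC n. \<Prod>V\<in>P. free_cumulant \<mu> (card V)) =
    (\<Prod>V\<in>{{1..n}}. free_cumulant \<mu> (card V)) +
    (\<Sum>P\<in>NC n - {{{1..n}}}. \<Prod>V\<in>P. free_cumulant \<mu> (card V))"
    using assms by (intro sum.remove top_in_NC) auto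
  then show ?thesis
    using assms by (simp add: free_cumulant.simps[of \<mu> n])
qed

lemma free_cumulant_unique:
  assumes "\<And>n. n > 0 \<Longrightarrow> moment \<mu> n = (\<Sum>P\<in>NC n. \<Prod>V\<in>P. c (card V))"
  shows "n > 0 \<Longrightarrow> free_cumulant \<mu> n = c n"
proof (induction n rule: less_induct)
  case (less n)
  have "moment \<mu> n = (\<Prod>V\<in>{{1..n}}. c (card V)) +
    (\<Sum>P\<in>NC n - {{{1..n}}}. \<Prod>V\<in>P. c (card V))"
    unfolding assms[OF less.prems] using less.prems by (intro sum.remove top_in_NC) auto
  moreover have "(\<Sum>P\<in>NC n - {{{1..n}}}. \<Prod>V\<in>P. c (card V)) =
    (\<Sum>P\<in>NC n - {{{1..n}}}. \<Prod>V\<in>P. free_cumulant \<mu> (card V))"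
  proof (intro sum.cong prod.cong refl)
    fix P V assume P: "P \<in> NC n - {{{1..n}}}" and V: "V \<in> P"
    have "card V < n" using NC_block_card P V by blast
    moreover have "V \<noteq> {}" "V \<subseteq> {1..n}"
      using P V by (auto simp: NC_def partition_on_def)
    then have "card V > 0"
      using card_gt_0_iff finite_subset by blast
    ultimately show "c (card V) = free_cumulant \<mu> (card V)"
      using less.IH by simp
  qed
  ultimately show ?case
    using less.prems by (simp add: free_cumulant.simps[of \<mu> n])
qed

text \<open>Every sequence is the free cumulant sequence of some distribution.\<close>

lemma ex_distribution_with_cumulants:
  "\<exists>\<mu>. is_distribution \<mu> \<and> (\<forall>n\<ge>1. free_cumulant \<mu> n = c n)"
proof -
  define m where "m k = (if k = 0 then 1 else \<Sum>P\<in>NC k. \<Prod>V\<in>P. c (card V))" for k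
  define \<mu> :: "complex poly \<Rightarrow> complex"
    where "\<mu> p = (\<Sum>k\<le>degree p. poly.coeff p k * m k)" for p
  have ext: "\<mu> p = (\<Sum>k\<le>N. poly.coeff p k * m k)" if "degree p \<le> N" for p N
    unfolding \<mu>_def using that
    by (intro sum.mono_neutral_left) (auto simp: coeff_eq_0)
  have "\<mu> (p + q) = \<mu> p + \<mu> q" for p q
  proof -
    define N where "N = max (degree p) (degree q)"
    have "\<mu> (p + q) = (\<Sum>k\<le>N. poly.coeff (p + q) k * m k)"
      by (intro ext) (auto simp: N_def degree_add_le_max)
    also have "\<dots> = \<mu> p + \<mu> q"
      by (subst (1 2) ext[of _ N]) (auto simp: N_def algebra_simps sum.distrib)
    finally show ?thesis .
  qed
  moreover have "\<mu> (Polynomial.smult a p) = a * \<mu> p" for a p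
    by (subst ext[of _ "degree p"]) (auto simp: \<mu>_def sum_distrib_left mult_ac)
  moreover have "\<mu> 1 = 1" by (simp add: \<mu>_def m_def)
  ultimately have dist: "is_distribution \<mu>" by (simp add: is_distribution_def)
  have "moment \<mu> n = m n" for n
    by (simp add: moment_def \<mu>_def degree_monom_eq if_distrib[of "\<lambda>x. x * _"] cong: if_cong)
  then have "free_cumulant \<mu> n = c n" if "n \<ge> 1" for n
    using that by (intro free_cumulant_unique) (auto simp: m_def)
  with dist show ?thesis by blast
qed

text \<open>The R-transform in the convention \<open>R\<^sub>\<mu>(z) = \<Sum>\<^sub>n\<^sub>\<ge>\<^sub>1 r\<^sub>n z\<^sup>n\<close> (not \<open>\<Sum>\<^sub>n\<^sub>\<ge>\<^sub>0 r\<^sub>n\<^sub>+\<^sub>1 z\<^sup>n\<close>).\<close>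

definition R_transform :: "(complex poly \<Rightarrow> complex) \<Rightarrow> complex fps" where
  "R_transform \<mu> = Abs_fps (\<lambda>n. if n = 0 then 0 else free_cumulant \<mu> n)"


section \<open>Noncrossing partitions adapted to words\<close>

datatype letter = L1 | L2 | L1s | L2s  \<comment> \<open>\<open>1\<close>, \<open>2\<close>, \<open>1\<^sup>*\<close>, \<open>2\<^sup>*\<close>\<close>

definition w1s :: "letter list" where "w1s = [L1s, L1]"
definition w2 :: "letter list" where "w2 = [L2, L2s]"

definition U_word :: "nat \<Rightarrow> letter list" where
  "U_word n = concat (replicate (n div 2) (w1s @ w2)) @ (if odd n then w1s else [])"

lemma U_word_even: "U_word (2 * m) = concat (replicate m (w1s @ w2))"
  and U_word_odd: "U_word (2 * m + 1) = concat (replicate m (w1s @ w2)) @ w1s"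
  by (simp_all add: U_word_def)

lemma length_U_word: "length (U_word n) = 2 * n"
proof -
  have "length (concat (replicate m (w1s @ w2))) = 4 * m" for m
    by (induction m) (auto simp: w1s_def w2_def)
  then have "length (U_word n) = 4 * (n div 2) + 2 * (n mod 2)"
    by (cases "even n") (auto simp: U_word_def w1s_def odd_iff_mod_2_eq_one)
  then show ?thesis by presburger
qed

text \<open>The cyclic successor of \<open>s\<close> in its block \<open>V\<close>.\<close>

definition block_succ :: "nat set \<Rightarrow> nat \<Rightarrow> nat" where
  "block_succ V s = (if s = Max V then Min V else Min {t \<in> V. s < t})"

definition admissible_pairs :: "(letter \<times> letter) set" where
  "admissible_pairs = {(L1, L2), (L1, L1s), (L2, L2s), (L1s, L1), (L2s, L2), (L2s, L1s)}"

text \<open>Positions in a word are counted from \<open>1\<close>, so that the \<open>s\<close>-th letter of \<open>w\<close> is \<open>w ! (s - 1)\<close>.\<close>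

definition NC_word :: "letter list \<Rightarrow> nat set set set" where
  "NC_word w = {P \<in> NC (length w). \<forall>V\<in>P. \<forall>s\<in>V.
     (w ! (s - 1), w ! (block_succ V s - 1)) \<in> admissible_pairs}"

definition Q :: "(nat \<Rightarrow> complex) \<Rightarrow> nat \<Rightarrow> complex" where
  "Q r n = (\<Sum>P\<in>NC_word (U_word n). \<Prod>V\<in>P. r (card V))"

definition psi :: "(nat \<Rightarrow> complex) \<Rightarrow> complex fps" where
  "psi r = Abs_fps (\<lambda>n. if n \<ge> 1 then Q r n else 0)"

definition psi_s :: "(nat \<Rightarrow> complex) \<Rightarrow> complex fps" where
  "psi_s r = Abs_fps (\<lambda>n. if n \<ge> 1 \<and> even n then Q r n else 0)"

end

theory Submission
  imports Defs
begin

text \<open>The identity is a recursion for the sums \<open>Q r n\<close>, obtained by looking at the block of the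
  first letter of the word.

  Number the letters of \<open>U_word n\<close> by \<open>1, 2, \<dots>, 2 * n\<close>. The letters repeat with period four, and
  the admissible pairs say that an odd position \<open>s\<close> can be followed in its block only by positions
  \<open>t\<close> with \<open>t mod 4 = Suc s mod 4\<close>, an even one by any odd position (\<open>admissible_iff_follows\<close>). So
  parities alternate along a block, and the block \<open>{1 = s\<^sub>1 < \<dots> < s\<^sub>2\<^sub>k}\<close> of \<open>1\<close> leaves \<open>2 * k\<close> gaps
  of two kinds: a gap after an even position begins at an odd one and has an arbitrary even
  length, while a gap after an odd position begins at an even one and has a length divisible by
  four. The rest of a noncrossing partition consists of independent adapted noncrossing partitions
  of the gaps (\<open>nc_sum_interval\<close>).

  Adaptedness is preserved when all positions are moved by two, so the gaps of the first kind
  contribute the series \<open>psi r + 1\<close> and those of the second kind a series \<open>E\<close> with only even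
  powers. Summation over \<open>k\<close> gives \<open>psi r = R(z (psi r + 1) E)\<close>, where \<open>R\<close> is the series of even
  cumulants. The same analysis of an interval of the second kind meets the same gaps, in the
  opposite order, so that its coefficients are also those of \<open>R(z (psi r + 1) E)\<close>
  (\<open>nc_sum_word_weight_conv_compose\<close> treats both kinds at once). Hence \<open>E\<close> is \<open>1\<close> plus the even
  part of \<open>psi r\<close>, that is \<open>psi_s r + 1\<close>, which turns the first equation into the assertion.\<close>


section \<open>Noncrossing partitions and the block of the least element\<close>

definition nc_on :: "nat set \<Rightarrow> nat set set set" where
  "nc_on A = {P. partition_on A P \<and> noncrossing P}"

definition nc_sum :: "(nat set \<Rightarrow> 'a::comm_ring_1) \<Rightarrow> nat set \<Rightarrow> 'a" where
  "nc_sum f A = (\<Sum>P\<in>nc_on A. \<Prod>V\<in>P. f V)"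

lemma finite_nc_on: "finite A \<Longrightarrow> finite (nc_on A)"
  by (rule finite_subset[of _ "Pow (Pow A)"]) (auto simp: nc_on_def partition_on_def)

lemma finite_nc_on_member: "finite A \<Longrightarrow> P \<in> nc_on A \<Longrightarrow> finite P"
  by (auto simp: nc_on_def intro: finite_elements)

lemma nc_sum_empty [simp]: "nc_sum f {} = 1"
proof -
  have "nc_on {} = {{}}"
    by (auto simp: nc_on_def noncrossing_def partition_on_def)
  then show ?thesis by (simp add: nc_sum_def)
qed

text \<open>If \<open>V\<close> is disjoint from \<open>A\<close> and has an element below all of \<open>A\<close>, the condition on the blocks
  \<open>W\<close> says exactly that \<open>W\<close> does not cross \<open>V\<close>. It refers to each element of \<open>V\<close> separately, so
  the elements of \<open>V\<close> can be removed one at a time.\<close>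

definition nc_avoiding :: "nat set \<Rightarrow> nat set \<Rightarrow> nat set set set" where
  "nc_avoiding A V = {P \<in> nc_on A. \<forall>W\<in>P. \<forall>v\<in>V. W \<subseteq> {..<v} \<or> W \<subseteq> {v<..}}"

lemma nc_avoiding_empty [simp]: "nc_avoiding A {} = nc_on A"
  by (simp add: nc_avoiding_def)

lemma partition_on_Un_disjoint:
  assumes "A \<inter> B = {}" "partition_on A P" "partition_on B R"
  shows "partition_on (A \<union> B) (P \<union> R)"
proof (rule partition_onI)
  fix p q assume pq: "p \<in> P \<union> R" "q \<in> P \<union> R" "p \<noteq> q"
  have "p \<subseteq> A" if "p \<in> P" for p using that partition_onD1[OF assms(2)] by blast
  moreover have "q \<subseteq> B" if "q \<in> R" for q using that partition_onD1[OF assms(3)] by blast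
  moreover have "disjoint P" "disjoint R" using assms(2,3) by (auto dest: partition_onD2)
  ultimately show "disjnt p q"
    using pq assms(1) disjointD[of P p q] disjointD[of R p q] unfolding disjnt_def by blast
qed (use assms in \<open>auto simp: partition_on_def\<close>)

lemma nc_avoiding_Un:
  assumes "A \<subseteq> {..<y}" "B \<subseteq> {y<..}" "V \<subseteq> {y<..}" "P \<in> nc_on A" "R \<in> nc_avoiding B V"
  shows "P \<union> R \<in> nc_avoiding (A \<union> B) (insert y V)"
proof -
  have PA: "W \<subseteq> A" if "W \<in> P" for W
    using that assms(4) by (auto simp: nc_on_def partition_on_def)
  have RB: "W \<subseteq> B" if "W \<in> R" for W
    using that assms(5) by (auto simp: nc_avoiding_def nc_on_def partition_on_def)
  have "partition_on (A \<union> B) (P \<union> R)"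
  proof -
    have "A \<inter> B = {}" using assms(1,2) by fastforce
    moreover have "partition_on A P" "partition_on B R"
      using assms(4,5) by (auto simp: nc_avoiding_def nc_on_def)
    ultimately show ?thesis
      by (simp add: partition_on_Un_disjoint)
  qed
  moreover have "noncrossing (P \<union> R)"
    unfolding noncrossing_def
  proof (intro ballI impI notI)
    fix V W assume VW: "V \<in> P \<union> R" "W \<in> P \<union> R" "V \<noteq> W"
      and "\<exists>a b c d. a < b \<and> b < c \<and> c < d \<and> a \<in> V \<and> c \<in> V \<and> b \<in> W \<and> d \<in> W"
    then obtain a b c d where *: "a < b" "b < c" "c < d" "a \<in> V" "c \<in> V" "b \<in> W" "d \<in> W"
      by blast
    have nc: "noncrossing P" "noncrossing R"
      using assms(4,5) by (auto simp: nc_on_def nc_avoiding_def)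
    consider "V \<in> P" "W \<in> P" | "V \<in> R" "W \<in> R" | "V \<in> P" "W \<in> R" | "V \<in> R" "W \<in> P"
      using VW by blast
    then show False
    proof cases
      case 1 then show ?thesis using nc(1) VW(3) * unfolding noncrossing_def by blast
    next
      case 2 then show ?thesis using nc(2) VW(3) * unfolding noncrossing_def by blast
    next
      case 3
      then have "c < y" "y < b" using * PA RB assms(1,2) by blast+
      then show ?thesis using * by simp
    next
      case 4
      then have "d < y" "y < a" using * PA RB assms(1,2) by blast+
      then show ?thesis using * by simp
    qed
  qed
  moreover have "W \<subseteq> {..<v} \<or> W \<subseteq> {v<..}" if "W \<in> P \<union> R" "v \<in> insert y V" for W v
  proof (cases "W \<in> P")
    case True
    have "y \<le> v" using that(2) assms(3) by auto
    moreover have "W \<subseteq> {..<y}" using PA[OF True] assms(1) by blast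
    ultimately show ?thesis by fastforce
  next
    case False
    then have W: "W \<in> R" using that by blast
    show ?thesis
    proof (cases "v = y")
      case True
      then show ?thesis using RB[OF W] assms(2) by blast
    next
      case False
      then show ?thesis using W that(2) assms(5) unfolding nc_avoiding_def by blast
    qed
  qed
  ultimately show ?thesis by (auto simp: nc_avoiding_def nc_on_def)
qed

lemma nc_avoiding_restrict:
  assumes "P \<in> nc_avoiding (A \<union> B) V" "A \<inter> B = {}" "\<And>W. W \<in> P \<Longrightarrow> W \<subseteq> A \<or> W \<subseteq> B" "V' \<subseteq> V"
  shows "P \<inter> Pow A \<in> nc_avoiding A V'"
proof -
  have *: "\<Union>P = A \<union> B" "disjoint P" "{} \<notin> P" "noncrossing P"
    using assms(1) by (auto simp: nc_avoiding_def nc_on_def partition_on_def)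
  have "\<Union>(P \<inter> Pow A) = A"
  proof -
    have "x \<in> \<Union>(P \<inter> Pow A)" if "x \<in> A" for x
    proof -
      obtain W where "W \<in> P" "x \<in> W" using \<open>x \<in> A\<close> *(1) by blast
      then show ?thesis using assms(2) assms(3)[of W] \<open>x \<in> A\<close> by blast
    qed
    then show ?thesis by blast
  qed
  moreover have "disjoint (P \<inter> Pow A)" using *(2) by (auto simp: disjoint_def)
  moreover have "noncrossing (P \<inter> Pow A)" using *(4) unfolding noncrossing_def by blast
  ultimately have "P \<inter> Pow A \<in> nc_on A" using *(3) by (auto simp: nc_on_def partition_on_def)
  then show ?thesis
    using assms(1,4) unfolding nc_avoiding_def by blast
qed

text \<open>No block can reach over \<open>y\<close>, hence a partition is a pair of independent partitions of the
  parts to the left and to the right of \<open>y\<close>.\<close>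

lemma nc_avoiding_split:
  assumes fin: "finite A" "finite B"
    and sub: "A \<subseteq> {..<y}" "B \<subseteq> {y<..}" "V \<subseteq> {y<..}"
  shows "(\<Sum>P\<in>nc_avoiding (A \<union> B) (insert y V). \<Prod>W\<in>P. f W) =
    nc_sum f A * (\<Sum>P\<in>nc_avoiding B V. \<Prod>W\<in>P. f W)"
proof -
  have disj: "A \<inter> B = {}" using sub by fastforce
  have blocks: "W \<subseteq> A \<and> \<not> W \<subseteq> B \<or> W \<subseteq> B \<and> \<not> W \<subseteq> A"
    if "P \<in> nc_avoiding (A \<union> B) (insert y V)" "W \<in> P" for P W
  proof -
    have W: "W \<subseteq> A \<union> B" "W \<noteq> {}" "W \<subseteq> {..<y} \<or> W \<subseteq> {y<..}"
      using that by (auto simp: nc_avoiding_def nc_on_def partition_on_def)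
    have "A \<inter> {y<..} = {}" "B \<inter> {..<y} = {}" using sub(1,2) by fastforce+
    then have "W \<subseteq> A \<or> W \<subseteq> B" using W(1,3) by blast
    then show ?thesis using W(2) disj by blast
  qed
  have "nc_sum f A * (\<Sum>P\<in>nc_avoiding B V. \<Prod>W\<in>P. f W) =
    (\<Sum>(P, R)\<in>nc_on A \<times> nc_avoiding B V. (\<Prod>W\<in>P. f W) * (\<Prod>W\<in>R. f W))"
    by (simp add: nc_sum_def sum_product sum.cartesian_product)
  also have "\<dots> = (\<Sum>P\<in>nc_avoiding (A \<union> B) (insert y V). \<Prod>W\<in>P. f W)"
  proof (rule sum.reindex_bij_witness[of _ "\<lambda>P. (P \<inter> Pow A, P \<inter> Pow B)" "\<lambda>(P, R). P \<union> R"])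
    fix PR assume "PR \<in> nc_on A \<times> nc_avoiding B V"
    then obtain P R where PR: "PR = (P, R)" "P \<in> nc_on A" "R \<in> nc_avoiding B V" by auto
    have P: "W \<subseteq> A \<and> W \<noteq> {}" if "W \<in> P" for W
      using that PR(2) by (auto simp: nc_on_def partition_on_def)
    have R: "W \<subseteq> B \<and> W \<noteq> {}" if "W \<in> R" for W
      using that PR(3) by (auto simp: nc_avoiding_def nc_on_def partition_on_def)
    have dPR: "P \<inter> R = {}" using P R disj by blast
    have "(P \<union> R) \<inter> Pow A = P" "(P \<union> R) \<inter> Pow B = R"
      using P R disj by blast+
    then show "(case PR of (P, R) \<Rightarrow> P \<union> R) \<in> nc_avoiding (A \<union> B) (insert y V)"
      and "(\<lambda>P. (P \<inter> Pow A, P \<inter> Pow B)) (case PR of (P, R) \<Rightarrow> P \<union> R) = PR"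
      using PR nc_avoiding_Un[OF sub PR(2,3)] by auto
    have "finite P" "finite R"
      using PR fin by (auto simp: nc_avoiding_def intro: finite_nc_on_member)
    then show "(\<Prod>W\<in>(case PR of (P, R) \<Rightarrow> P \<union> R). f W) =
        (case PR of (P, R) \<Rightarrow> (\<Prod>W\<in>P. f W) * (\<Prod>W\<in>R. f W))"
      using dPR by (simp add: PR prod.union_disjoint)
  next
    fix P assume P: "P \<in> nc_avoiding (A \<union> B) (insert y V)"
    show "(case (P \<inter> Pow A, P \<inter> Pow B) of (P, R) \<Rightarrow> P \<union> R) = P"
      using blocks[OF P] by auto
    have "P \<inter> Pow A \<in> nc_avoiding A {}"
      using P blocks[OF P] disj by (intro nc_avoiding_restrict) auto
    moreover have "P \<inter> Pow B \<in> nc_avoiding B V"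
      using P blocks[OF P] disj
      by (intro nc_avoiding_restrict[where A = B and B = A and V = "insert y V"]) (auto simp: Un_commute)
    ultimately show "(P \<inter> Pow A, P \<inter> Pow B) \<in> nc_on A \<times> nc_avoiding B V" by simp
  qed
  finally show ?thesis ..
qed

text \<open>The factors belong to the consecutive pairs of the list \<open>a # ys @ [b]\<close>.\<close>

fun gap_prod :: "(nat \<Rightarrow> nat \<Rightarrow> 'a::comm_ring_1) \<Rightarrow> nat \<Rightarrow> nat \<Rightarrow> nat list \<Rightarrow> 'a" where
  "gap_prod g a b [] = g a b"
| "gap_prod g a b (y # ys) = g a y * gap_prod g y b ys"

definition increasing_lists :: "nat \<Rightarrow> nat \<Rightarrow> nat list set" where
  "increasing_lists a b = {ys. sorted_wrt (<) (a # ys @ [b])}"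

lemma nc_avoiding_gap_prod:
  assumes "ys \<in> increasing_lists a b"
  shows "(\<Sum>P\<in>nc_avoiding ({Suc a..<b} - set ys) (set ys). \<Prod>W\<in>P. f W) =
    gap_prod (\<lambda>s t. nc_sum f {Suc s..<t}) a b ys"
  using assms
proof (induction ys arbitrary: a)
  case Nil
  then show ?case by (simp add: nc_sum_def)
next
  case (Cons y ys)
  have s: "a < y" "y < b" "\<forall>z\<in>set ys. y < z" and ys: "ys \<in> increasing_lists y b"
    using Cons.prems by (auto simp: increasing_lists_def)
  have *: "{Suc a..<b} - set (y # ys) = {Suc a..<y} \<union> ({Suc y..<b} - set ys)"
    using s by force
  have "(\<Sum>P\<in>nc_avoiding ({Suc a..<b} - set (y # ys)) (set (y # ys)). \<Prod>W\<in>P. f W) =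
    nc_sum f {Suc a..<y} * (\<Sum>P\<in>nc_avoiding ({Suc y..<b} - set ys) (set ys). \<Prod>W\<in>P. f W)"
    unfolding * unfolding list.set(2) using s by (intro nc_avoiding_split) auto
  then show ?case using Cons.IH[OF ys] by simp
qed

text \<open>A block \<open>W\<close> with elements on both sides of some \<open>v \<in> V\<close> crosses \<open>V\<close>, because \<open>V\<close> also
  contains \<open>a\<close>, which lies to the left of everything. Conversely, of two crossing blocks each has
  an element strictly between two elements of the other.\<close>

lemma nc_insert_first_block_iff:
  assumes V: "V \<subseteq> A" "a \<in> V" and a: "\<And>x. x \<in> A \<Longrightarrow> a \<le> x" and "V \<notin> P"
  shows "insert V P \<in> nc_on A \<longleftrightarrow> P \<in> nc_avoiding (A - V) V"
proof
  assume P: "insert V P \<in> nc_on A"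
  then have *: "\<Union>P \<union> V = A" "disjoint (insert V P)" "{} \<notin> P" "noncrossing (insert V P)"
    by (auto simp: nc_on_def partition_on_def)
  have disj: "W \<inter> V = {}" if "W \<in> P" for W
    using that \<open>V \<notin> P\<close> disjointD[OF *(2), of W V] by auto
  then have "partition_on (A - V) P"
    using *(1-3) unfolding partition_on_def by (auto simp: disjoint_def)
  moreover have "noncrossing P" using *(4) unfolding noncrossing_def by blast
  moreover have "W \<subseteq> {..<v} \<or> W \<subseteq> {v<..}" if "W \<in> P" "v \<in> V" for W v
  proof (rule ccontr)
    assume "\<not> ?thesis"
    then obtain x y where xy: "x \<in> W" "y \<in> W" "v \<le> x" "y \<le> v" by fastforce
    have ne: "x \<noteq> v" "y \<noteq> v" "y \<noteq> a" using disj[OF that(1)] xy that(2) V(2) by blast+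
    have "y \<in> A" using *(1) that xy by blast
    then have "a < y" using a ne(3) by (simp add: le_neq_implies_less)
    moreover have "W \<noteq> V" using \<open>V \<notin> P\<close> that by blast
    moreover have "y < v" "v < x" using xy ne by auto
    ultimately show False
      using *(4) that xy V(2) unfolding noncrossing_def by blast
  qed
  ultimately show "P \<in> nc_avoiding (A - V) V" by (auto simp: nc_avoiding_def nc_on_def)
next
  assume P: "P \<in> nc_avoiding (A - V) V"
  then have *: "\<Union>P = A - V" "disjoint P" "{} \<notin> P" "noncrossing P"
    by (auto simp: nc_avoiding_def nc_on_def partition_on_def)
  have str: "W \<subseteq> {..<v} \<or> W \<subseteq> {v<..}" if "W \<in> P" "v \<in> V" for W v
    using P that by (auto simp: nc_avoiding_def)
  have "partition_on A (insert V P)"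
  proof -
    have "partition_on (A - V) P" using *(1-3) by (simp add: partition_on_def)
    moreover have "disjnt V (\<Union>P)" using *(1) by (auto simp: disjnt_def)
    ultimately show ?thesis using V by (subst partition_on_insert) auto
  qed
  moreover have "noncrossing (insert V P)"
    unfolding noncrossing_def
  proof (intro ballI impI notI)
    fix X W assume XW: "X \<in> insert V P" "W \<in> insert V P" "X \<noteq> W"
      and "\<exists>a b c d. a < b \<and> b < c \<and> c < d \<and> a \<in> X \<and> c \<in> X \<and> b \<in> W \<and> d \<in> W"
    then obtain p q s t where pq: "p < q" "q < s" "s < t" "p \<in> X" "s \<in> X" "q \<in> W" "t \<in> W"
      by blast
    consider "X = V" "W \<in> P" | "W = V" "X \<in> P" | "X \<in> P" "W \<in> P" using XW by blast
    then show False
    proof cases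
      case 1 then show ?thesis using str[of W s] pq by fastforce
    next
      case 2 then show ?thesis using str[of X q] pq by fastforce
    next
      case 3 then show ?thesis using *(4) XW(3) pq unfolding noncrossing_def by blast
    qed
  qed
  ultimately show "insert V P \<in> nc_on A" by (simp add: nc_on_def)
qed

lemma nc_sum_by_first_block:
  assumes A: "finite A" "a \<in> A" "\<And>x. x \<in> A \<Longrightarrow> a \<le> x"
  shows "nc_sum f A =
    (\<Sum>V\<in>{V. V \<subseteq> A \<and> a \<in> V}. f V * (\<Sum>P\<in>nc_avoiding (A - V) V. \<Prod>W\<in>P. f W))"
proof -
  let ?S = "Sigma {V. V \<subseteq> A \<and> a \<in> V} (\<lambda>V. nc_avoiding (A - V) V)"
  have notin: "V \<notin> P" if "P \<in> nc_avoiding (A - V) V" "a \<in> V" for V P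
    using that by (auto simp: nc_avoiding_def nc_on_def partition_on_def)
  have "(\<Sum>V\<in>{V. V \<subseteq> A \<and> a \<in> V}. f V * (\<Sum>P\<in>nc_avoiding (A - V) V. \<Prod>W\<in>P. f W)) =
    (\<Sum>(V, P)\<in>?S. f V * (\<Prod>W\<in>P. f W))"
    using A(1) finite_nc_on by (subst sum.Sigma[symmetric]) (auto simp: sum_distrib_left nc_avoiding_def)
  also have "\<dots> = nc_sum f A"
    unfolding nc_sum_def
  proof (rule sum.reindex_bij_witness[of _
        "\<lambda>P. let V = THE V. V \<in> P \<and> a \<in> V in (V, P - {V})" "\<lambda>(V, P). insert V P"])
    fix VP assume "VP \<in> ?S"
    then obtain V P where VP: "VP = (V, P)" "V \<subseteq> A" "a \<in> V" "P \<in> nc_avoiding (A - V) V" by auto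
    have nin: "V \<notin> P" using notin VP by blast
    have "W = V" if "W \<in> insert V P" "a \<in> W" for W
    proof (rule ccontr)
      assume "W \<noteq> V"
      then have "W \<in> P" using that(1) by blast
      then have "W \<subseteq> A - V" using VP(4) by (auto simp: nc_avoiding_def nc_on_def partition_on_def)
      then show False using that(2) VP(3) by blast
    qed
    then have "(THE W. W \<in> insert V P \<and> a \<in> W) = V" using VP(3) by (intro the_equality) auto
    then show "(let W = THE W. W \<in> (case VP of (V, P) \<Rightarrow> insert V P) \<and> a \<in> W
        in (W, (case VP of (V, P) \<Rightarrow> insert V P) - {W})) = VP"
      using nin by (simp add: VP(1) Let_def)
    show "(case VP of (V, P) \<Rightarrow> insert V P) \<in> nc_on A"
      using nc_insert_first_block_iff[OF VP(2,3) A(3) nin] VP by simp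
    have "finite P" using VP(4) A(1) by (auto simp: nc_avoiding_def intro: finite_nc_on_member)
    then show "(\<Prod>W\<in>(case VP of (V, P) \<Rightarrow> insert V P). f W) =
        (case VP of (V, P) \<Rightarrow> f V * (\<Prod>W\<in>P. f W))"
      using nin by (simp add: VP(1))
  next
    fix P assume P: "P \<in> nc_on A"
    then have *: "\<Union>P = A" "disjoint P" by (auto simp: nc_on_def partition_on_def)
    then obtain V where V: "V \<in> P" "a \<in> V" using A(2) by blast
    have the: "(THE V. V \<in> P \<and> a \<in> V) = V"
      using V *(2) by (intro the_equality) (auto simp: disjoint_def)
    have ins: "insert V (P - {V}) = P" using V by blast
    show "(case (let V = THE V. V \<in> P \<and> a \<in> V in (V, P - {V})) of (V, P) \<Rightarrow> insert V P) = P"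
      using ins by (simp add: the)
    have "V \<subseteq> A" using V * by blast
    then have "P - {V} \<in> nc_avoiding (A - V) V"
      using nc_insert_first_block_iff[of V A a "P - {V}"] V(2) A(3) P by (simp only: ins) simp
    then show "(let V = THE V. V \<in> P \<and> a \<in> V in (V, P - {V})) \<in> ?S"
      using V \<open>V \<subseteq> A\<close> by (simp add: the)
  qed
  finally show ?thesis ..
qed

lemma finite_increasing_lists: "finite (increasing_lists a b)"
proof (rule finite_subset)
  show "increasing_lists a b \<subseteq> sorted_list_of_set ` Pow {..<b}"
  proof
    fix ys assume "ys \<in> increasing_lists a b"
    then have "sorted_wrt (<) ys" "set ys \<subseteq> {..<b}" by (auto simp: increasing_lists_def sorted_wrt_append)
    then show "ys \<in> sorted_list_of_set ` Pow {..<b}"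
      by (metis PowI image_eqI sorted_list_of_set.idem_if_sorted_distinct strict_sorted_iff)
  qed
qed auto

text \<open>The block of \<open>a\<close> is listed increasingly as \<open>a # ys\<close>; it cuts \<open>{a..<b}\<close> into the gaps
  \<open>{Suc s..<t}\<close> for consecutive elements \<open>s\<close>, \<open>t\<close>, where the end point \<open>b\<close> closes the last gap.\<close>

lemma nc_sum_interval:
  assumes "a < b"
  shows "nc_sum f {a..<b} =
    (\<Sum>ys\<in>increasing_lists a b. f (set (a # ys)) * gap_prod (\<lambda>s t. nc_sum f {Suc s..<t}) a b ys)"
proof -
  have "nc_sum f {a..<b} = (\<Sum>V\<in>{V. V \<subseteq> {a..<b} \<and> a \<in> V}.
      f V * (\<Sum>P\<in>nc_avoiding ({a..<b} - V) V. \<Prod>W\<in>P. f W))"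
    using assms by (intro nc_sum_by_first_block) auto
  also have "\<dots> = (\<Sum>ys\<in>increasing_lists a b.
      f (set (a # ys)) * gap_prod (\<lambda>s t. nc_sum f {Suc s..<t}) a b ys)"
  proof (rule sum.reindex_bij_witness[of _ "\<lambda>ys. set (a # ys)" "\<lambda>V. sorted_list_of_set (V - {a})"])
    fix V assume "V \<in> {V. V \<subseteq> {a..<b} \<and> a \<in> V}"
    then have V: "V \<subseteq> {a..<b}" "a \<in> V" by auto
    then have fin: "finite (V - {a})" using finite_subset by blast
    let ?ys = "sorted_list_of_set (V - {a})"
    have "x < b" "a \<le> x" if "x \<in> V" for x using that V by auto
    then show ch: "?ys \<in> increasing_lists a b"
      using V fin assms by (auto simp: increasing_lists_def sorted_wrt_append le_neq_implies_less)
    show set: "set (a # ?ys) = V" using V fin by auto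
    have "{a..<b} - V = {Suc a..<b} - V"
      proof -
      have "{a..<b} = insert a {Suc a..<b}" using assms by auto
      then show ?thesis using V(2) by simp
    qed
    then have "{a..<b} - V = {Suc a..<b} - set ?ys" using V fin by auto
    moreover have "nc_avoiding ({a..<b} - V) V = nc_avoiding ({a..<b} - V) (set ?ys)"
    proof -
      have "W \<subseteq> {a<..}" if "P \<in> nc_on ({a..<b} - V)" "W \<in> P" for P W
      proof
        fix x assume "x \<in> W"
        then have "x \<in> {a..<b} - V" using that by (auto simp: nc_on_def partition_on_def)
        moreover have "x \<noteq> a" using calculation V(2) by blast
        ultimately show "x \<in> {a<..}" by simp
      qed
      moreover have "set ?ys = V - {a}" using fin by simp
      ultimately show ?thesis unfolding nc_avoiding_def by (intro Collect_cong) blast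
    qed
    ultimately show "f (set (a # ?ys)) * gap_prod (\<lambda>s t. nc_sum f {Suc s..<t}) a b ?ys =
        f V * (\<Sum>P\<in>nc_avoiding ({a..<b} - V) V. \<Prod>W\<in>P. f W)"
      using nc_avoiding_gap_prod[OF ch, of f] set by simp
  next
    fix ys assume "ys \<in> increasing_lists a b"
    then have s: "sorted_wrt (<) (a # ys)" "set ys \<subseteq> {a<..<b}"
      by (auto simp: increasing_lists_def sorted_wrt_append)
    then have "set (a # ys) - {a} = set ys" "sorted ys" "distinct ys"
      by (auto simp: strict_sorted_iff)
    then show "sorted_list_of_set (set (a # ys) - {a}) = ys"
      by (simp add: sorted_list_of_set.idem_if_sorted_distinct)
    show "set (a # ys) \<in> {V. V \<subseteq> {a..<b} \<and> a \<in> V}" using s(2) assms by fastforce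
  qed
  finally show ?thesis .
qed


section \<open>Adapted blocks\<close>

text \<open>The admissible pairs of letters, in terms of positions. At the odd positions stand \<open>L1s\<close> and
  \<open>L2\<close>, each of which has one admissible successor, the next letter of the word; at the even
  positions stand \<open>L1\<close> and \<open>L2s\<close>, which can be followed by both \<open>L1s\<close> and \<open>L2\<close>.\<close>

definition follows :: "nat \<Rightarrow> nat \<Rightarrow> bool" where
  "follows s t \<longleftrightarrow> (if odd s then t mod 4 = Suc s mod 4 else odd t)"

lemma follows_parity: "follows s t \<Longrightarrow> odd t \<longleftrightarrow> even s"
  unfolding follows_def by (cases "odd s") (simp_all, presburger)

lemma follows_shift:
  assumes "even d"
  shows "follows (d + s) (d + t) \<longleftrightarrow> follows s t"
proof -
  have add2: "(2 + x) mod 4 = (2 + y) mod 4 \<longleftrightarrow> x mod 4 = y mod 4" for x y :: nat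
  proof
    assume "(2 + x) mod 4 = (2 + y) mod 4"
    then have "(2 + (2 + x)) mod 4 = (2 + (2 + y)) mod 4" by (rule mod_add_cong[OF refl])
    then show "x mod 4 = y mod 4" by simp
  qed (rule mod_add_cong[OF refl])
  have step: "follows (2 + s) (2 + t) \<longleftrightarrow> follows s t" for s t
    unfolding follows_def using add2[of t "Suc s"] by simp
  obtain k where d: "d = 2 * k" using assms by (elim evenE)
  show ?thesis unfolding d
  proof (induction k)
    case (Suc k)
    then show ?case using step[of "2 * k + s" "2 * k + t"] by simp
  qed simp
qed

lemma even_conv_mod4: "even k \<longleftrightarrow> k mod 4 = 0 \<or> k mod 4 = 2" for k :: nat
  by presburger

text \<open>The next two lemmas allow the end point \<open>b\<close> of an interval to stand in for its first
  position \<open>a\<close> when the last element of a block is required to be followed by the first one.\<close>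

lemma follows_cong_odd: "odd a \<Longrightarrow> odd b \<Longrightarrow> follows s a \<longleftrightarrow> follows s b"
  using follows_parity[of s a] follows_parity[of s b] by (auto simp: follows_def)

lemma follows_cong_mod4: "a mod 4 = b mod 4 \<Longrightarrow> follows s a \<longleftrightarrow> follows s b"
  unfolding follows_def even_conv_mod4[of a] even_conv_mod4[of b] by simp

lemma U_word_conv_map:
  "U_word n = map (\<lambda>i. [L1s, L1, L2, L2s] ! (i mod 4)) [0..<2 * n]"
proof -
  let ?f = "\<lambda>i. [L1s, L1, L2, L2s] ! (i mod 4)"
  have rep: "concat (replicate m (w1s @ w2)) = map ?f [0..<4 * m]" for m
  proof (induction m)
    case (Suc m)
    have "concat (replicate (Suc m) (w1s @ w2)) = concat (replicate m (w1s @ w2)) @ (w1s @ w2)"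
      by (metis append_Nil2 concat.simps concat_append replicate_Suc replicate_append_same)
    also have "\<dots> = map ?f ([0..<4 * m] @ [4 * m, Suc (4 * m), Suc (Suc (4 * m)), Suc (Suc (Suc (4 * m)))])"
      by (simp add: Suc.IH[symmetric] w1s_def w2_def mod_Suc)
    also have "[0..<4 * m] @ [4 * m, Suc (4 * m), Suc (Suc (4 * m)), Suc (Suc (Suc (4 * m)))] = [0..<4 * Suc m]"
    proof -
      have "4 * Suc m = Suc (Suc (Suc (Suc (4 * m))))" by simp
      then show ?thesis by (simp only: upt_Suc) simp
    qed
    finally show ?case .
  qed simp
  show ?thesis
  proof (cases "even n")
    case True
    then obtain m where "n = 2 * m" by (elim evenE)
    then show ?thesis using U_word_even[of m] rep[of m] by simp
  next
    case False
    then obtain m where n: "n = 2 * m + 1" by (elim oddE)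
    then show ?thesis
      unfolding n U_word_odd rep by (simp add: w1s_def mod_Suc)
  qed
qed

lemma admissible_iff_follows:
  assumes "s \<in> {1..2 * n}" "t \<in> {1..2 * n}"
  shows "(U_word n ! (s - 1), U_word n ! (t - 1)) \<in> admissible_pairs \<longleftrightarrow> follows s t"
proof -
  obtain i j where ij: "s = Suc i" "t = Suc j" "i < 2 * n" "j < 2 * n"
    using assms by (cases s; cases t) auto
  have m4: "k mod 4 = 0 \<or> k mod 4 = 1 \<or> k mod 4 = 2 \<or> k mod 4 = 3" for k :: nat by presburger
  have fol: "follows (Suc i) (Suc j) \<longleftrightarrow>
    (i mod 4, j mod 4) \<in> {(0, 1), (2, 3), (1, 0), (1, 2), (3, 0), (3, 2)}"
    unfolding follows_def even_Suc even_conv_mod4[of i] even_conv_mod4[of j] mod_Suc[of j]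
      mod_Suc[of "Suc i"] mod_Suc[of i]
    using m4[of i] m4[of j] by (elim disjE) simp_all
  show ?thesis
    using m4[of i] m4[of j] ij(3,4)
    unfolding ij(1,2) fol
    by (elim disjE) (simp_all add: U_word_conv_map admissible_pairs_def numeral_3_eq_3 numeral_2_eq_2)
qed

definition adapted :: "nat set \<Rightarrow> bool" where
  "adapted V \<longleftrightarrow> (\<forall>s\<in>V. follows s (block_succ V s))"

text \<open>With weight zero for the blocks that are not adapted, the sum over adapted partitions
  becomes a sum over all noncrossing partitions.\<close>

definition word_weight :: "(nat \<Rightarrow> complex) \<Rightarrow> nat set \<Rightarrow> complex" where
  "word_weight r V = (if adapted V then r (card V) else 0)"

lemma block_succ_mem: "finite V \<Longrightarrow> s \<in> V \<Longrightarrow> block_succ V s \<in> V"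
proof -
  assume V: "finite V" "s \<in> V"
  have "Min {t \<in> V. s < t} \<in> {t \<in> V. s < t}" if "s \<noteq> Max V"
  proof (rule Min_in)
    have "s < Max V" using V that by (simp add: le_neq_implies_less)
    moreover have "Max V \<in> V" using V by (intro Max_in) auto
    ultimately show "{t \<in> V. s < t} \<noteq> {}" by blast
  qed (use V in simp)
  moreover have "Min V \<in> V" using V by (intro Min_in) auto
  ultimately show ?thesis unfolding block_succ_def by auto
qed

lemma Q_conv_nc_sum: "Q r n = nc_sum (word_weight r) {1..2 * n}"
proof -
  have word: "NC_word (U_word n) = {P \<in> nc_on {1..2 * n}. \<forall>V\<in>P. adapted V}"
  proof -
    have "(\<forall>s\<in>V. (U_word n ! (s - 1), U_word n ! (block_succ V s - 1)) \<in> admissible_pairs)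
      \<longleftrightarrow> adapted V" if "P \<in> nc_on {1..2 * n}" "V \<in> P" for P V
    proof -
      have V: "V \<subseteq> {1..2 * n}" using that by (auto simp: nc_on_def partition_on_def)
      then have "finite V" using finite_subset by blast
      then show ?thesis
        unfolding adapted_def
        using V block_succ_mem[of V] by (intro ball_cong refl admissible_iff_follows) blast+
    qed
    moreover have "NC (length (U_word n)) = nc_on {1..2 * n}"
      by (simp add: NC_def nc_on_def length_U_word)
    ultimately show ?thesis unfolding NC_word_def by blast
  qed
  have "nc_sum (word_weight r) {1..2 * n} =
    (\<Sum>P\<in>NC_word (U_word n). \<Prod>V\<in>P. r (card V))"
    unfolding nc_sum_def word
  proof (rule sum.mono_neutral_cong_right)
    show "finite (nc_on {1..2 * n})" by (simp add: finite_nc_on)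
    show "\<forall>P\<in>nc_on {1..2 * n} - {P \<in> nc_on {1..2 * n}. \<forall>V\<in>P. adapted V}. prod (word_weight r) P = 0"
    proof
      fix P assume P: "P \<in> nc_on {1..2 * n} - {P \<in> nc_on {1..2 * n}. \<forall>V\<in>P. adapted V}"
      then obtain V where "V \<in> P" "\<not> adapted V" by blast
      moreover have "finite P" using P by (auto intro: finite_nc_on_member)
      ultimately show "prod (word_weight r) P = 0"
        by (intro prod_zero) (auto simp: word_weight_def)
    qed
  qed (auto simp: word_weight_def)
  then show ?thesis by (simp add: Q_def)
qed

lemma block_succ_nth:
  assumes "sorted_wrt (<) xs" "i < length xs"
  shows "block_succ (set xs) (xs ! i) = (xs @ [hd xs]) ! Suc i"
proof -
  have less: "xs ! j < xs ! k \<longleftrightarrow> j < k" if "j < length xs" "k < length xs" for j k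
    using assms(1) that by (metis less_asym linorder_neqE_nat sorted_wrt_nth_less)
  have le: "xs ! j \<le> xs ! k \<longleftrightarrow> j \<le> k" if "j < length xs" "k < length xs" for j k
    using less[OF that(2,1)] by (simp add: not_less[symmetric])
  show ?thesis
  proof (cases "Suc i = length xs")
    case True
    have "y \<le> xs ! i" if "y \<in> set xs" for y
      using that True assms(2) by (auto simp: in_set_conv_nth le)
    then have "Max (set xs) = xs ! i" using assms(2) by (intro Max_eqI) auto
    moreover have "Min (set xs) = xs ! 0"
    proof (intro Min_eqI)
      have "0 < length xs" using assms(2) by (cases xs) auto
      then show "xs ! 0 \<in> set xs" by simp
      show "xs ! 0 \<le> y" if "y \<in> set xs" for y
        using that \<open>0 < length xs\<close> le[of 0] by (auto simp: in_set_conv_nth)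
    qed simp
    moreover have "xs \<noteq> []" using assms(2) by auto
    ultimately show ?thesis using True by (simp add: block_succ_def nth_append hd_conv_nth)
  next
    case False
    then have i: "Suc i < length xs" using assms(2) by simp
    then have "xs ! i < xs ! Suc i" using less assms(2) by simp
    also have "\<dots> \<le> Max (set xs)" using i by (intro Max_ge) auto
    finally have "xs ! i \<noteq> Max (set xs)" by simp
    moreover have "Min {t \<in> set xs. xs ! i < t} = xs ! Suc i"
      using i by (intro Min_eqI) (auto simp: in_set_conv_nth le less)
    ultimately show ?thesis using i by (simp add: block_succ_def nth_append)
  qed
qed

lemma adapted_set_iff:
  assumes "sorted_wrt (<) (a # ys)"
  shows "adapted (set (a # ys)) \<longleftrightarrow> successively follows ((a # ys) @ [a])"
proof -
  let ?xs = "a # ys"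
  have "adapted (set ?xs) \<longleftrightarrow> (\<forall>i<length ?xs. follows (?xs ! i) (block_succ (set ?xs) (?xs ! i)))"
    unfolding adapted_def all_set_conv_all_nth ..
  also have "\<dots> \<longleftrightarrow> (\<forall>i<length ?xs. follows ((?xs @ [a]) ! i) ((?xs @ [a]) ! Suc i))"
  proof (intro all_cong1 imp_cong refl)
    fix i assume "i < length ?xs"
    then have "block_succ (set ?xs) (?xs ! i) = (?xs @ [a]) ! Suc i"
      using block_succ_nth[OF assms, of i] by simp
    moreover have "(?xs @ [a]) ! i = ?xs ! i"
      using \<open>i < length ?xs\<close> nth_append[of ?xs "[a]" i] by (simp only: if_True)
    ultimately show "follows (?xs ! i) (block_succ (set ?xs) (?xs ! i)) =
        follows ((?xs @ [a]) ! i) ((?xs @ [a]) ! Suc i)"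
      by presburger
  qed
  also have "\<dots> \<longleftrightarrow> successively follows (?xs @ [a])"
    by (simp add: successively_conv_nth)
  finally show ?thesis .
qed

lemma gap_prod_restrict:
  "gap_prod (\<lambda>s t. if R s t then g s t else 0) a b ys =
    (if successively R ((a # ys) @ [b]) then gap_prod g a b ys else 0)"
  by (induction ys arbitrary: a) auto

text \<open>Distributing the condition that \<open>a # ys\<close> is adapted over the consecutive pairs turns it into
  a factor of each gap; only \<open>length ys\<close> then remains to be remembered of the block.\<close>

definition word_gap :: "(nat \<Rightarrow> complex) \<Rightarrow> nat \<Rightarrow> nat \<Rightarrow> complex" where
  "word_gap r s t = (if follows s t then nc_sum (word_weight r) {Suc s..<t} else 0)"

text \<open>The block \<open>a # ys\<close> is adapted if each consecutive pair of the cyclic list \<open>a # ys @ [a]\<close> is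
  admissible. By the hypothesis on \<open>b\<close> the final \<open>a\<close> can be replaced by \<open>b\<close>, so that the closing
  pair is treated like the other ones.\<close>

lemma nc_sum_word_weight_interval:
  assumes "a < b" and closing: "\<And>s. follows s a \<longleftrightarrow> follows s b"
  shows "nc_sum (word_weight r) {a..<b} =
    (\<Sum>ys\<in>increasing_lists a b. r (Suc (length ys)) * gap_prod (word_gap r) a b ys)"
  unfolding nc_sum_interval[OF assms(1)]
proof (rule sum.cong[OF refl])
  fix ys assume "ys \<in> increasing_lists a b"
  then have s: "sorted_wrt (<) (a # ys)" by (auto simp: increasing_lists_def sorted_wrt_append)
  have "card (set (a # ys)) = length (a # ys)"
    using s by (intro distinct_card) (auto simp: strict_sorted_iff)
  moreover have "adapted (set (a # ys)) \<longleftrightarrow> successively follows ((a # ys) @ [b])"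
    unfolding adapted_set_iff[OF s] successively_append_iff using closing by simp
  ultimately show "word_weight r (set (a # ys)) *
      gap_prod (\<lambda>s t. nc_sum (word_weight r) {Suc s..<t}) a b ys =
      r (Suc (length ys)) * gap_prod (word_gap r) a b ys"
    unfolding word_gap_def gap_prod_restrict word_weight_def by simp
qed


section \<open>Invariance under translation\<close>

lemma block_succ_shift:
  assumes "finite V" "s \<in> V"
  shows "block_succ ((+) d ` V) (d + s) = d + block_succ V s"
proof -
  have mono: "mono ((+) d)" by (simp add: mono_def)
  have ne: "V \<noteq> {}" using assms by auto
  have Max: "Max ((+) d ` V) = d + Max V" and Min: "Min ((+) d ` V) = d + Min V"
    using mono_Max_commute[OF mono assms(1) ne] mono_Min_commute[OF mono assms(1) ne] by simp_all
  have "Min {t \<in> (+) d ` V. d + s < t} = d + Min {t \<in> V. s < t}" if "s \<noteq> Max V"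
  proof -
    have "s < Max V" using assms that by (simp add: le_neq_implies_less)
    moreover have "Max V \<in> V" using assms by (intro Max_in) auto
    ultimately have "{t \<in> V. s < t} \<noteq> {}" by blast
    moreover have "{t \<in> (+) d ` V. d + s < t} = (+) d ` {t \<in> V. s < t}" by auto
    ultimately show ?thesis
      using mono_Min_commute[OF mono, of "{t \<in> V. s < t}"] assms(1) by simp
  qed
  then show ?thesis by (simp add: block_succ_def Max Min)
qed

lemma word_weight_shift:
  assumes "finite V" "even d"
  shows "word_weight r ((+) d ` V) = word_weight r V"
proof -
  have "adapted ((+) d ` V) \<longleftrightarrow> adapted V"
    unfolding adapted_def using assms by (simp add: block_succ_shift follows_shift)
  then show ?thesis by (simp add: word_weight_def card_image)
qed

lemma crossing_image_iff:
  fixes h :: "nat \<Rightarrow> nat"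
  assumes h: "strict_mono h"
  shows "(\<exists>a b c d. a < b \<and> b < c \<and> c < d \<and> a \<in> h ` V \<and> c \<in> h ` V \<and> b \<in> h ` W \<and> d \<in> h ` W)
    \<longleftrightarrow> (\<exists>a b c d. a < b \<and> b < c \<and> c < d \<and> a \<in> V \<and> c \<in> V \<and> b \<in> W \<and> d \<in> W)"
    (is "?L \<longleftrightarrow> ?R")
proof
  assume ?L
  then obtain a b c d where "a \<in> V" "c \<in> V" "b \<in> W" "d \<in> W" "h a < h b" "h b < h c" "h c < h d"
    by auto
  then show ?R using strict_mono_less[OF h] by blast
next
  assume ?R
  then obtain a b c d where "a \<in> V" "c \<in> V" "b \<in> W" "d \<in> W" "h a < h b" "h b < h c" "h c < h d"
    using strict_mono_less[OF h] by blast
  then show ?L by blast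
qed

lemma nc_on_image_iff:
  assumes h: "strict_mono h"
  shows "(`) h ` P \<in> nc_on (h ` A) \<longleftrightarrow> P \<in> nc_on A"
proof -
  have inj: "inj h" using h by (rule strict_mono_imp_inj_on)
  have "\<Union>((`) h ` P) = h ` (\<Union>P)" by blast
  then have "partition_on (h ` A) ((`) h ` P) \<longleftrightarrow> partition_on A P"
    by (auto simp: partition_on_def disjoint_def inj_image_eq_iff[OF inj] image_Int[OF inj, symmetric])
  moreover have "noncrossing ((`) h ` P) \<longleftrightarrow> noncrossing P"
  proof -
    have "(\<forall>X\<in>(`) h ` P. S X) \<longleftrightarrow> (\<forall>V\<in>P. S (h ` V))" for S by blast
    then show ?thesis
      unfolding noncrossing_def by (simp only: crossing_image_iff[OF h] inj_image_eq_iff[OF inj])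
  qed
  ultimately show ?thesis by (simp add: nc_on_def)
qed

lemma nc_sum_image:
  assumes h: "strict_mono h" and f: "\<And>V. V \<subseteq> A \<Longrightarrow> f (h ` V) = f V"
  shows "nc_sum f (h ` A) = nc_sum f A"
proof -
  let ?h = "(`) ((`) h)"
  have inj0: "inj h" using h by (rule strict_mono_imp_inj_on)
  have inj1: "inj ((`) h)" by (rule injI) (simp add: inj_image_eq_iff[OF inj0])
  have inj: "inj ?h" by (rule injI) (simp add: inj_image_eq_iff[OF inj1])
  have "nc_on (h ` A) = ?h ` nc_on A"
  proof
    show "nc_on (h ` A) \<subseteq> ?h ` nc_on A"
    proof
      fix R assume R: "R \<in> nc_on (h ` A)"
      have "h ` (h -` W) = W" if "W \<in> R" for W
      proof -
        have "W \<subseteq> h ` A" using that R by (auto simp: nc_on_def partition_on_def)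
        then show ?thesis by blast
      qed
      then have "(\<lambda>W. h ` (h -` W)) ` R = (\<lambda>W. W) ` R" by (intro image_cong refl)
      moreover have "?h ((-`) h ` R) = (\<lambda>W. h ` (h -` W)) ` R"
        by (simp add: image_image)
      ultimately have eq: "R = ?h ((-`) h ` R)" by simp
      with R have "?h ((-`) h ` R) \<in> nc_on (h ` A)" by simp
      then have "(-`) h ` R \<in> nc_on A" by (simp only: nc_on_image_iff[OF h])
      with eq show "R \<in> ?h ` nc_on A" by (rule image_eqI)
    qed
    show "?h ` nc_on A \<subseteq> nc_on (h ` A)"
      by (rule image_subsetI) (simp only: nc_on_image_iff[OF h])
  qed
  then have "nc_sum f (h ` A) = (\<Sum>P\<in>nc_on A. \<Prod>W\<in>?h P. f W)"
    unfolding nc_sum_def using inj by (simp add: sum.reindex inj_on_subset)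
  also have "\<dots> = nc_sum f A"
    unfolding nc_sum_def
  proof (rule sum.cong[OF refl])
    fix P assume P: "P \<in> nc_on A"
    have "inj_on ((`) h) P" by (rule inj_on_subset[OF inj1]) simp
    moreover have "V \<subseteq> A" if "V \<in> P" for V using that P by (auto simp: nc_on_def partition_on_def)
    ultimately show "(\<Prod>W\<in>?h P. f W) = (\<Prod>W\<in>P. f W)"
      by (simp add: prod.reindex f)
  qed
  finally show ?thesis .
qed

lemma nc_sum_word_weight_shift:
  assumes "even d"
  shows "nc_sum (word_weight r) {d + a..<d + b} = nc_sum (word_weight r) {a..<b}"
proof -
  have "word_weight r ((+) d ` V) = word_weight r V" if "V \<subseteq> {a..<b}" for V
    using that assms finite_subset by (intro word_weight_shift) auto
  then show ?thesis
    using nc_sum_image[of "(+) d" "{a..<b}" "word_weight r"] by (simp add: strict_mono_def add.commute)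
qed

lemma word_gap_shift: "even d \<Longrightarrow> word_gap r (d + s) (d + t) = word_gap r s t"
  using nc_sum_word_weight_shift[of d r "Suc s" t] by (simp add: word_gap_def follows_shift)

section \<open>Generating series of the gaps\<close>

primrec alternating_prod :: "(bool \<Rightarrow> 'a::comm_ring_1) \<Rightarrow> nat \<Rightarrow> bool \<Rightarrow> 'a" where
  "alternating_prod C 0 c = 1"
| "alternating_prod C (Suc k) c = C c * alternating_prod C k (\<not> c)"

lemma alternating_prod_even: "alternating_prod C (2 * k) c = (C True * C False) ^ k"
proof (induction k)
  case (Suc k)
  have "alternating_prod C (2 * Suc k) c = C c * C (\<not> c) * alternating_prod C (2 * k) c" by simp
  also have "C c * C (\<not> c) = C True * C False" by (cases c) simp_all
  finally show ?case by (simp only: Suc power_Suc)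
qed simp

lemma alternating_prod_odd: "alternating_prod C (Suc (2 * k)) c = C c * (C True * C False) ^ k"
  using alternating_prod_even[of C k "\<not> c"] by simp

lemma increasing_lists_Suc:
  "{ys \<in> increasing_lists a b. length ys = Suc k} =
    (\<Union>y\<in>{a<..<b}. (#) y ` {ys \<in> increasing_lists y b. length ys = k})"
proof -
  have "ys \<in> (\<Union>y\<in>{a<..<b}. (#) y ` {ys \<in> increasing_lists y b. length ys = k})"
    if "ys \<in> increasing_lists a b" "length ys = Suc k" for ys
    using that by (cases ys) (auto simp: increasing_lists_def)
  moreover have "y # ys \<in> increasing_lists a b" if "ys \<in> increasing_lists y b" "a < y" "y < b" for y ys
  proof -
    have "\<forall>z\<in>set ys. y < z" using that(1) by (simp add: increasing_lists_def)
    then have "\<forall>z\<in>set ys. a < z" using that(2) less_trans by blast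
    then show ?thesis using that by (simp add: increasing_lists_def)
  qed
  ultimately show ?thesis by auto
qed

text \<open>A sum of products over all ways to cut \<open>{a..<b}\<close> into steps is a coefficient of a product of
  series, one for each step. All steps have odd length, because only odd powers occur in \<open>C\<close>; so
  the parity of the position, on which the series of a step depends, alternates.\<close>

lemma sum_gap_prod_increasing_lists:
  fixes C :: "bool \<Rightarrow> 'a::comm_ring_1 fps"
  assumes g: "\<And>s t. s < t \<Longrightarrow> g s t = fps_nth (C (odd s)) (t - s)"
    and C: "\<And>c n. even n \<Longrightarrow> fps_nth (C c) n = 0"
    and "a < b"
  shows "(\<Sum>ys | ys \<in> increasing_lists a b \<and> length ys = k. gap_prod g a b ys) =
    fps_nth (alternating_prod C (Suc k) (odd a)) (b - a)"
  using \<open>a < b\<close>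
proof (induction k arbitrary: a)
  case 0
  then have "{ys. ys \<in> increasing_lists a b \<and> length ys = 0} = {[]}" by (auto simp: increasing_lists_def)
  then show ?case using 0 by (simp add: g)
next
  case (Suc k)
  let ?alt = "alternating_prod C (Suc k) (\<not> odd a)"
  have fin: "finite {ys \<in> increasing_lists y b. length ys = k}" for y using finite_increasing_lists by simp
  have "(\<Sum>ys | ys \<in> increasing_lists a b \<and> length ys = Suc k. gap_prod g a b ys) =
    (\<Sum>y\<in>{a<..<b}. \<Sum>ys\<in>(#) y ` {ys \<in> increasing_lists y b. length ys = k}. gap_prod g a b ys)"
    unfolding increasing_lists_Suc using fin by (intro sum.UNION_disjoint) auto
  also have "\<dots> = (\<Sum>y\<in>{a<..<b}. g a y *
      (\<Sum>ys | ys \<in> increasing_lists y b \<and> length ys = k. gap_prod g y b ys))"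
    by (simp add: sum.reindex sum_distrib_left)
  also have "\<dots> = (\<Sum>y\<in>{a<..<b}. fps_nth (C (odd a)) (y - a) * fps_nth ?alt (b - y))"
  proof (rule sum.cong[OF refl])
    fix y assume y: "y \<in> {a<..<b}"
    show "g a y * (\<Sum>ys | ys \<in> increasing_lists y b \<and> length ys = k. gap_prod g y b ys) =
        fps_nth (C (odd a)) (y - a) * fps_nth ?alt (b - y)"
    proof (cases "even (y - a)")
      case True
      then show ?thesis using y by (simp add: g C)
    next
      case False
      then have "odd y \<longleftrightarrow> \<not> odd a" using y by auto
      then show ?thesis using y Suc.IH[of y] by (simp add: g)
    qed
  qed
  also have "\<dots> = (\<Sum>i\<in>{0<..<b - a}. fps_nth (C (odd a)) i * fps_nth ?alt (b - a - i))"
    by (rule sum.reindex_bij_witness[of _ "\<lambda>i. a + i" "\<lambda>y. y - a"]) auto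
  also have "\<dots> = (\<Sum>i=0..b - a. fps_nth (C (odd a)) i * fps_nth ?alt (b - a - i))"
  proof (rule sum.mono_neutral_left)
    have "fps_nth (C c) 0 = 0" for c by (simp add: C)
    then have "fps_nth (C (odd a)) i * fps_nth ?alt (b - a - i) = 0" if "i = 0 \<or> i = b - a" for i
      using that by auto
    then show "\<forall>i\<in>{0..b - a} - {0<..<b - a}.
        fps_nth (C (odd a)) i * fps_nth ?alt (b - a - i) = 0" by auto
  qed auto
  finally show ?case by (simp only: alternating_prod.simps(2)[of C "Suc k"] fps_mult_nth)
qed

text \<open>The intervals of length \<open>2 * n\<close> that begin at an even position. As gaps of a block they lie
  between an odd position and a position congruent to its successor modulo four, so only even \<open>n\<close>
  occur.\<close>

definition even_start_series :: "(nat \<Rightarrow> complex) \<Rightarrow> complex fps" where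
  "even_start_series r =
    Abs_fps (\<lambda>n. if even n then nc_sum (word_weight r) {2..<2 + 2 * n} else 0)"

text \<open>A step from one element of a block to the next one: the factor \<open>fps_X\<close> stands for the
  element and the second factor for the gap. The argument \<open>c\<close> tells whether the step starts at an
  odd position. The exponent counts positions, of which there are two for each power of \<open>z\<close> in
  \<open>psi r\<close>, whence the substitution of \<open>fps_X ^ 2\<close>.\<close>

definition step_series :: "(nat \<Rightarrow> complex) \<Rightarrow> bool \<Rightarrow> complex fps" where
  "step_series r c =
    fps_X * ((if c then even_start_series r else psi r + 1) oo fps_X ^ 2)"

lemma psi_plus_1_nth: "fps_nth (psi r + 1) n = nc_sum (word_weight r) {1..<Suc (2 * n)}"
  by (cases "n = 0") (simp_all add: psi_def Q_conv_nc_sum atLeastLessThanSuc_atLeastAtMost)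

lemma step_series_even: "even n \<Longrightarrow> fps_nth (step_series r c) n = 0"
  by (cases n) (auto simp: step_series_def fps_nth_compose_X_power)

lemma word_gap_conv_step_series:
  assumes "s < t"
  shows "word_gap r s t = fps_nth (step_series r (odd s)) (t - s)"
proof (cases "even (t - s)")
  case True
  then have "odd s \<longleftrightarrow> odd t" using assms by auto
  then have "\<not> follows s t" using follows_parity by blast
  then show ?thesis using True by (simp add: word_gap_def step_series_even)
next
  case False
  then obtain n where "t - s = 2 * n + 1" by (elim oddE)
  then have t: "t = s + Suc (2 * n)" using assms by simp
  have nth: "fps_nth (step_series r c) (Suc (2 * n)) =
      fps_nth (if c then even_start_series r else psi r + 1) n" for c
    unfolding step_series_def by (simp only: fps_X_mult_nth) (simp add: fps_nth_compose_X_power)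
  show ?thesis
  proof (cases "odd s")
    case True
    then obtain d where d: "s = d + 1" "even d" by (elim oddE) auto
    have "follows s t \<longleftrightarrow> even n"
      using True unfolding t follows_def by simp presburger
    moreover have "nc_sum (word_weight r) {Suc s..<t} = nc_sum (word_weight r) {2..<2 + 2 * n}"
      using nc_sum_word_weight_shift[OF d(2), of r 2 "2 + 2 * n"] by (simp add: t d numeral_2_eq_2)
    ultimately show ?thesis
      using True nth[of True] by (simp add: t word_gap_def even_start_series_def)
  next
    case False
    then have "even s" by simp
    moreover have "follows s t" using False unfolding t follows_def by simp
    moreover have "nc_sum (word_weight r) {Suc s..<t} = nc_sum (word_weight r) {1..<Suc (2 * n)}"
      using nc_sum_word_weight_shift[OF \<open>even s\<close>, of r 1 "Suc (2 * n)"] by (simp add: t)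
    ultimately show ?thesis
      using nth[of False] psi_plus_1_nth[of r n] by (simp add: t word_gap_def)
  qed
qed

section \<open>The functional equation\<close>

definition even_cumulant_series :: "(nat \<Rightarrow> complex) \<Rightarrow> complex fps" where
  "even_cumulant_series r = Abs_fps (\<lambda>n. if n = 0 then 0 else r (2 * n))"

lemma sum_double: "(\<Sum>k<2 * n. h k) = (\<Sum>i<n. h (2 * i) + h (Suc (2 * i)))"
  for h :: "nat \<Rightarrow> 'a::comm_monoid_add"
  by (induction n) (simp_all add: add.assoc)

text \<open>A step from an odd position and one from an even position together have the series
  \<open>G oo fps_X ^ 2\<close> with \<open>G = fps_X * (psi r + 1) * even_start_series r\<close>, in either order. Hence a block with \<open>2 * i\<close> elements
  contributes \<open>r (2 * i) * G ^ i\<close>. Blocks of odd size contribute nothing, since the total length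
  of an odd number of odd steps is odd. The result depends on \<open>n\<close> but not on \<open>a\<close>: this identifies
  the intervals that begin at odd positions with those that begin at even ones.\<close>

lemma nc_sum_word_weight_conv_compose:
  assumes "n > 0" and closing: "\<And>s. follows s a \<longleftrightarrow> follows s (a + 2 * n)"
  shows "nc_sum (word_weight r) {a..<a + 2 * n} =
    fps_nth (even_cumulant_series r oo (fps_X * (psi r + 1) * even_start_series r)) n"
proof -
  define C where "C = step_series r"
  define G where "G = fps_X * (psi r + 1) * even_start_series r"
  let ?b = "a + 2 * n" and ?alt = "\<lambda>k. fps_nth (alternating_prod C (Suc k) (odd a)) (2 * n)"
  have X2: "fps_nth (fps_X ^ 2 :: complex fps) 0 = 0" by simp
  have CC: "C True * C False = G oo fps_X ^ 2"
  proof -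
    have "G oo fps_X ^ 2 =
        fps_X ^ 2 * ((psi r + 1) oo fps_X ^ 2) * (even_start_series r oo fps_X ^ 2)"
      by (simp only: G_def fps_compose_mult_distrib[OF X2] fps_X_fps_compose_startby0[OF X2])
    then show ?thesis by (simp add: C_def step_series_def power2_eq_square mult_ac)
  qed
  have alt_odd: "?alt (Suc (2 * i)) = fps_nth (G ^ Suc i) n" for i
  proof -
    have "alternating_prod C (Suc (Suc (2 * i))) (odd a) = G ^ Suc i oo fps_X ^ 2"
      using alternating_prod_even[of C "Suc i" "odd a"]
      by (simp add: CC fps_compose_power[OF X2] fps_compose_mult_distrib[OF X2] del: alternating_prod.simps)
    then show ?thesis by (simp add: fps_nth_compose_X_power del: power_Suc alternating_prod.simps)
  qed
  have alt_even: "?alt (2 * i) = 0" for i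
  proof -
    let ?F = "if odd a then even_start_series r else psi r + 1"
    have "alternating_prod C (Suc (2 * i)) (odd a) = fps_X * (?F * G ^ i oo fps_X ^ 2)"
      unfolding alternating_prod_odd CC
      by (simp add: C_def step_series_def fps_compose_power[OF X2] fps_compose_mult_distrib[OF X2] mult_ac)
    then show ?thesis using assms(1)
      by (simp add: fps_nth_compose_X_power del: alternating_prod.simps)
  qed
  have len: "length ys < 2 * n" if "ys \<in> increasing_lists a ?b" for ys
  proof -
    have "set ys \<subseteq> {a<..<?b}" "distinct ys"
      using that by (auto simp: increasing_lists_def sorted_wrt_append strict_sorted_iff)
    then have "length ys \<le> card {a<..<?b}" by (metis card_mono distinct_card finite_greaterThanLessThan)
    then show ?thesis using assms(1) by simp
  qed
  have "nc_sum (word_weight r) {a..<?b} =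
    (\<Sum>ys\<in>increasing_lists a ?b. r (Suc (length ys)) * gap_prod (word_gap r) a ?b ys)"
    using assms by (intro nc_sum_word_weight_interval) auto
  also have "\<dots> = (\<Sum>k<2 * n. \<Sum>ys | ys \<in> increasing_lists a ?b \<and> length ys = k.
      r (Suc (length ys)) * gap_prod (word_gap r) a ?b ys)"
    using len finite_increasing_lists by (intro sum.group[symmetric]) auto
  \<comment> \<open>The list \<open>ys\<close> omits the first element \<open>a\<close> of the block, hence the shift from \<open>k\<close> to \<open>Suc k\<close>.\<close>
  also have "\<dots> = (\<Sum>k<2 * n. r (Suc k) * ?alt k)"
  proof (rule sum.cong[OF refl])
    fix k
    have "(\<Sum>ys | ys \<in> increasing_lists a ?b \<and> length ys = k. gap_prod (word_gap r) a ?b ys) = ?alt k"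
      using sum_gap_prod_increasing_lists[of "word_gap r" C a ?b k] assms(1)
      by (simp add: C_def word_gap_conv_step_series step_series_even del: alternating_prod.simps)
    then show "(\<Sum>ys | ys \<in> increasing_lists a ?b \<and> length ys = k.
        r (Suc (length ys)) * gap_prod (word_gap r) a ?b ys) = r (Suc k) * ?alt k"
      by (simp add: sum_distrib_left[symmetric] del: alternating_prod.simps)
  qed
  also have "\<dots> = (\<Sum>i<n. r (2 * Suc i) * fps_nth (G ^ Suc i) n)"
    unfolding sum_double alt_odd alt_even by simp
  also have "\<dots> = (\<Sum>i=0..n. fps_nth (even_cumulant_series r) i * fps_nth (G ^ i) n)"
    by (simp add: sum.atLeast0_atMost_Suc_shift even_cumulant_series_def atLeast0AtMost sum.atMost_shift)
  finally show ?thesis by (simp add: fps_compose_nth G_def)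
qed

text \<open>The intervals starting at \<open>1\<close> give the equation with \<open>even_start_series r\<close> in place of
  \<open>psi_s r + 1\<close>, those starting at \<open>2\<close> show that the two series agree.\<close>

lemma psi_functional_equation:
  "psi r = even_cumulant_series r oo (fps_X * (psi r + 1) * (psi_s r + 1))"
proof -
  let ?F = "even_cumulant_series r oo (fps_X * (psi r + 1) * even_start_series r)"
  have psi: "fps_nth (psi r) n = fps_nth ?F n" for n
  proof (cases "n = 0")
    case False
    have "fps_nth (psi r) n = nc_sum (word_weight r) {1..<1 + 2 * n}"
      using False psi_plus_1_nth[of r n] by simp
    also have "\<dots> = fps_nth ?F n"
      using False by (intro nc_sum_word_weight_conv_compose follows_cong_odd) auto
    finally show ?thesis .
  qed (simp add: psi_def even_cumulant_series_def)
  have "fps_nth (even_start_series r) n = fps_nth (psi_s r + 1) n" for n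
  proof (cases "even n \<and> n > 0")
    case True
    then have "(2 + 2 * n) mod 4 = 2 mod 4" by presburger
    then have "nc_sum (word_weight r) {2..<2 + 2 * n} = fps_nth ?F n"
      using True by (intro nc_sum_word_weight_conv_compose follows_cong_mod4) auto
    then have "fps_nth (even_start_series r) n = fps_nth ?F n"
      using True by (simp only: even_start_series_def fps_nth_Abs_fps if_True)
    also have "\<dots> = fps_nth (psi_s r + 1) n"
      using True psi[of n] by (simp add: psi_def psi_s_def)
    finally show ?thesis .
  qed (auto simp: even_start_series_def psi_s_def)
  then have "even_start_series r = psi_s r + 1" by (intro fps_ext)
  then show ?thesis using psi by (intro fps_ext) simp
qed

theorem lemma7p1:
  fixes M :: "nat \<Rightarrow> 'w measure"
    and U :: "'u set"
    and Y :: "'u \<Rightarrow> nat \<Rightarrow> 'w \<Rightarrow> complex mat"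
    and u :: 'u
    and \<nu> \<nu>' :: "complex poly \<Rightarrow> complex"
    and r :: "nat \<Rightarrow> complex"
  assumes "\<And>n. prob_space (M n)"
    and "\<And>u. u \<in> U \<Longrightarrow> hermitian_random_matrix M (Y u)"
    and "indep_random_matrices M U Y"
    and "asymptotically_free M U (\<lambda>u. {Y u})"
    and "asymptotically_free_from_diagonal M (Y ` U)"
    and "uniformly_bounded_ae M U Y"
    and "u \<in> U"
    and "asymptotic_distribution M (Y u) \<nu>"
    and "\<And>n. n \<ge> 1 \<Longrightarrow> r n = free_cumulant \<nu> n"
    and "is_distribution \<nu>'"
    and "R_transform \<nu>' = Abs_fps (\<lambda>n. if n = 0 then 0 else r (2 * n))"
  shows "psi r = R_transform \<nu>' oo (fps_X * (psi r + 1) * (psi_s r + 1))"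
proof -
  have "R_transform \<nu>' = even_cumulant_series r"
    using assms(11) by (simp add: even_cumulant_series_def)
  then show ?thesis using psi_functional_equation[of r] by simp
qed

end
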